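(* Let $\varphi\in L^\infty(\mathbb{T})$. With respect to the orthogonal decomposition $L^2(\mathbb{T})=\mathcal{M}\oplus\mathcal{M}^\perp$, the multiplication operator $M_\varphi$ has the block matrix representation $$M_\varphi=\begin{bmatrix} V A_\varphi^{\mathcal{M}} V^* & (B_{\bar\varphi}^{\mathcal{M}})^*\\ B_\varphi^{\mathcal{M}} & D_\varphi^{\mathcal{M}}\end{bmatrix},$$ where $D_\varphi^{\mathcal{M}}=P_{\mathcal{M}^\perp}M_\varphi|_{\mathcal{M}^\perp}$.
   Context: $\mathbb{D}$ is the open unit disk, $\mathbb{T}=\partial\mathbb{D}$, and $L^2(\mathbb{T})$ is taken with respect to normalized Lebesgue measure $m$, with inner product linear in the first variable. $H^2\subset L^2(\mathbb{T})$ is the Hardy space (functions with vanishing negative Fourier coefficients, also viewed as analytic functions on $\mathbb{D}$). For $f\in H^2$, $S^*f=(f-f(0))/z$. For an inner function $u$, $\mathcal{K}_u=H^2\ominus uH^2$. A closed subspace $\mathcal{M}\subset H^2$ is nearly $S^*$-invariant if $f\in\mathcal{M}$, $f(0)=0$ imply $S^*f\in\mathcal{M}$. Setting: $\mathcal{M}=h\mathcal{K}_u$ is a nonzero proper closed nearly $S^*$-invariant subspace of $H^2$, where $u$ is a nonconstant inner function with $u(0)=0$ and $h\in\mathcal{M}$ is the extremal function of $\mathcal{M}$: $\|h\|_2=1$, $h(0)>0$, $h\perp\{f\in\mathcal{M}:f(0)=0\}$, and multiplication by $h$ is an isometry from $\mathcal{K}_u$ onto $\mathcal{M}$. $\mathcal{M}^\perp=L^2(\mathbb{T})\ominus\mathcal{M}$;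 $P_{\mathcal{M}}$ and $P_{\mathcal{M}^\perp}$ are the orthogonal projections of $L^2(\mathbb{T})$ onto $\mathcal{M}$ and $\mathcal{M}^\perp$. $M_\varphi f=\varphi f$ on $L^2(\mathbb{T})$. $V:\mathcal{K}_u\to L^2(\mathbb{T})$, $Vk=hk$, is an isometry with range $\mathcal{M}$, so $VV^*=P_{\mathcal{M}}$ and $V$ is unitary from $\mathcal{K}_u$ onto $\mathcal{M}$ (in the top-left block $V$ and $V^*$ are taken between $\mathcal{K}_u$ and $\mathcal{M}$). For $\varphi\in L^\infty(\mathbb{T})$: $A_\varphi^{\mathcal{M}}=V^*P_{\mathcal{M}}M_\varphi V:\mathcal{K}_u\to\mathcal{K}_u$; $B_\varphi^{\mathcal{M}}=P_{\mathcal{M}^\perp}M_\varphi|_{\mathcal{M}}:\mathcal{M}\to\mathcal{M}^\perp$ (the weighted big truncated Hankel operator). *)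

theory Defs
  imports "HOL-Analysis.Analysis"
begin

section \<open>The Hilbert space of square-integrable functions on the unit circle\<close>

definition circle_measure :: "complex measure" where
  "circle_measure =
     distr (uniform_measure lborel {0..2 * pi}) (restrict_space borel (sphere 0 1)) cis"

lemma emeasure_circle_measure_space: "emeasure circle_measure (space circle_measure) = 1"
proof -
  have [measurable]: "cis \<in> borel_measurable borel"
    by (intro borel_measurable_continuous_onI continuous_intros)
  have cis: "cis \<in> measurable (uniform_measure lborel {0..2 * pi}) (restrict_space borel (sphere 0 1))"
    by (rule measurable_restrict_space2) auto
  show ?thesis
    unfolding circle_measure_def
    by (subst emeasure_distr[OF cis])
      (auto simp: vimage_def space_restrict_space sets_restrict_space_iff emeasure_uniform_measure_1)
qed

definition square_integrable :: "(complex \<Rightarrow> complex) set" where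
  "square_integrable =
     {f \<in> borel_measurable circle_measure. integrable circle_measure (\<lambda>z. (cmod (f z))\<^sup>2)}"

text \<open>\<open>Linf\<close> consists of functions, not of classes modulo null sets.\<close>

definition Linf :: "(complex \<Rightarrow> complex) set" where
  "Linf = {\<phi> \<in> borel_measurable circle_measure. \<exists>C. AE z in circle_measure. cmod (\<phi> z) \<le> C}"

definition l2_rel :: "(complex \<Rightarrow> complex) \<Rightarrow> (complex \<Rightarrow> complex) \<Rightarrow> bool" where
  "l2_rel f g \<longleftrightarrow>
     f \<in> square_integrable \<and> g \<in> square_integrable \<and> (AE z in circle_measure. f z = g z)"

lemma square_integrable_zero: "(\<lambda>z. 0) \<in> square_integrable"
  by (simp add: square_integrable_def)

lemma square_integrable_mult_Linf:
  assumes "\<phi> \<in> Linf" "f \<in> square_integrable"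
  shows "(\<lambda>z. \<phi> z * f z) \<in> square_integrable"
proof -
  from assms have [measurable]: "\<phi> \<in> borel_measurable circle_measure"
      "f \<in> borel_measurable circle_measure"
    and int: "integrable circle_measure (\<lambda>z. (cmod (f z))\<^sup>2)"
    by (auto simp: Linf_def square_integrable_def)
  obtain C where C: "AE z in circle_measure. cmod (\<phi> z) \<le> C"
    using assms by (auto simp: Linf_def)
  have "integrable circle_measure (\<lambda>z. (cmod (\<phi> z * f z))\<^sup>2)"
  proof (rule Bochner_Integration.integrable_bound)
    show "integrable circle_measure (\<lambda>z. C\<^sup>2 * (cmod (f z))\<^sup>2)"
      using int by simp
    show "AE z in circle_measure.
        norm ((cmod (\<phi> z * f z))\<^sup>2) \<le> norm (C\<^sup>2 * (cmod (f z))\<^sup>2)"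
      using C by eventually_elim
        (auto simp: norm_mult power_mult_distrib intro!: mult_right_mono power_mono)
  qed measurable
  then show ?thesis by (simp add: square_integrable_def)
qed

lemma square_integrable_cmult:
  "f \<in> square_integrable \<Longrightarrow> (\<lambda>z. c * f z) \<in> square_integrable"
  by (rule square_integrable_mult_Linf) (auto simp: Linf_def intro: exI[of _ "cmod c"])

lemma square_integrable_add:
  assumes "f \<in> square_integrable" "g \<in> square_integrable"
  shows "(\<lambda>z. f z + g z) \<in> square_integrable"
proof -
  from assms have [measurable]: "f \<in> borel_measurable circle_measure"
      "g \<in> borel_measurable circle_measure"
    and int: "integrable circle_measure (\<lambda>z. (cmod (f z))\<^sup>2)"
      "integrable circle_measure (\<lambda>z. (cmod (g z))\<^sup>2)"
    by (auto simp: square_integrable_def)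
  have bound: "(cmod (a + b))\<^sup>2 \<le> 2 * (cmod a)\<^sup>2 + 2 * (cmod b)\<^sup>2" for a b
  proof -
    have "(cmod (a + b))\<^sup>2 \<le> (cmod a + cmod b)\<^sup>2"
      by (intro power_mono norm_triangle_ineq) auto
    also have "\<dots> \<le> 2 * (cmod a)\<^sup>2 + 2 * (cmod b)\<^sup>2"
      using sum_squares_bound[of "cmod a" "cmod b"] by (simp add: power2_sum)
    finally show ?thesis .
  qed
  have "integrable circle_measure (\<lambda>z. (cmod (f z + g z))\<^sup>2)"
  proof (rule Bochner_Integration.integrable_bound)
    show "integrable circle_measure (\<lambda>z. 2 * (cmod (f z))\<^sup>2 + 2 * (cmod (g z))\<^sup>2)"
      using int by simp
  qed (use bound in auto)
  then show ?thesis by (simp add: square_integrable_def)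
qed

lemma integrable_mult_cnj:
  assumes "f \<in> square_integrable" "g \<in> square_integrable"
  shows "integrable circle_measure (\<lambda>z. f z * cnj (g z))"
proof -
  from assms have [measurable]: "f \<in> borel_measurable circle_measure"
      "g \<in> borel_measurable circle_measure"
    and int: "integrable circle_measure (\<lambda>z. (cmod (f z))\<^sup>2)"
      "integrable circle_measure (\<lambda>z. (cmod (g z))\<^sup>2)"
    by (auto simp: square_integrable_def)
  have bound: "cmod a * cmod b \<le> (cmod a)\<^sup>2 + (cmod b)\<^sup>2" for a b
  proof -
    have "0 \<le> cmod a * cmod b" by simp
    then show ?thesis
      using sum_squares_bound[of "cmod a" "cmod b"] by linarith
  qed
  have [measurable]: "(\<lambda>z. cnj (g z)) \<in> borel_measurable circle_measure"
    by (intro borel_measurable_continuous_on[of cnj]) (auto intro: continuous_intros)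
  show ?thesis
  proof (rule Bochner_Integration.integrable_bound)
    show "integrable circle_measure (\<lambda>z. (cmod (f z))\<^sup>2 + (cmod (g z))\<^sup>2)"
      using int by simp
  qed (use bound in \<open>auto simp: norm_mult\<close>)
qed

quotient_type l2T = "complex \<Rightarrow> complex" / partial: l2_rel
proof (rule part_equivpI)
  show "\<exists>f. l2_rel f f"
    using square_integrable_zero by (auto simp: l2_rel_def)
  show "symp l2_rel"
    by (auto simp: symp_def l2_rel_def)
  show "transp l2_rel"
    by (auto simp: transp_def l2_rel_def elim: AE_mp)
qed

lemma rep_l2T_square_integrable: "rep_l2T f \<in> square_integrable"
  using Quotient3_rep_reflp[OF Quotient3_l2T, of f] by (simp add: l2_rel_def)

lemma rep_abs_l2T_AE:
  "f \<in> square_integrable \<Longrightarrow> AE z in circle_measure. rep_l2T (abs_l2T f) z = f z"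
  using rep_abs_rsp_left[OF Quotient3_l2T, of f f] by (simp add: l2_rel_def)

instantiation l2T :: real_vector
begin

lift_definition zero_l2T :: l2T is "\<lambda>z. 0"
  by (simp add: l2_rel_def square_integrable_zero)

lift_definition plus_l2T :: "l2T \<Rightarrow> l2T \<Rightarrow> l2T" is "\<lambda>f g z. f z + g z"
  by (auto simp: l2_rel_def square_integrable_add)

lift_definition uminus_l2T :: "l2T \<Rightarrow> l2T" is "\<lambda>f z. - f z"
  using square_integrable_cmult[where c="-1"] by (auto simp: l2_rel_def)

lift_definition minus_l2T :: "l2T \<Rightarrow> l2T \<Rightarrow> l2T" is "\<lambda>f g z. f z - g z"
  using square_integrable_cmult[where c="-1"] square_integrable_add[where g="\<lambda>z. - g z" for g]
  by (fastforce simp: l2_rel_def)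

lift_definition scaleR_l2T :: "real \<Rightarrow> l2T \<Rightarrow> l2T" is "\<lambda>r f z. of_real r * f z"
  using square_integrable_cmult by (auto simp: l2_rel_def)

instance
proof
  fix a b :: real and x y z :: l2T
  show "x + y + z = x + (y + z)"
    by transfer (simp add: l2_rel_def square_integrable_add add.assoc)
  show "x + y = y + x"
    by transfer (simp add: l2_rel_def square_integrable_add add.commute)
  show "0 + x = x"
    by transfer (simp add: l2_rel_def)
  show "- x + x = 0"
    by transfer (simp add: l2_rel_def square_integrable_zero)
  show "x - y = x + - y"
    by transfer
      (use square_integrable_cmult[where c="-1"] square_integrable_add[where g="\<lambda>z. - g z" for g]
        in \<open>fastforce simp: l2_rel_def\<close>)
  show "a *\<^sub>R (x + y) = a *\<^sub>R x + a *\<^sub>R y"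
    by transfer (simp add: l2_rel_def square_integrable_add square_integrable_cmult distrib_left)
  show "(a + b) *\<^sub>R x = a *\<^sub>R x + b *\<^sub>R x"
    by transfer (use square_integrable_cmult square_integrable_add in
        \<open>simp add: l2_rel_def distrib_right\<close>)
  show "a *\<^sub>R b *\<^sub>R x = (a * b) *\<^sub>R x"
    by transfer (use square_integrable_cmult in
        \<open>simp add: l2_rel_def mult.assoc\<close>)
  show "1 *\<^sub>R x = x"
    by transfer (simp add: l2_rel_def)
qed

end

lift_definition cinner :: "l2T \<Rightarrow> l2T \<Rightarrow> complex" is
  "\<lambda>f g. \<integral>z. f z * cnj (g z) \<partial>circle_measure"
proof -
  fix f f' g g'
  assume "l2_rel f f'" "l2_rel g g'"
  then have "AE z in circle_measure. f z * cnj (g z) = f' z * cnj (g' z)"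
    and "integrable circle_measure (\<lambda>z. f z * cnj (g z))"
    and "integrable circle_measure (\<lambda>z. f' z * cnj (g' z))"
    by (auto simp: l2_rel_def integrable_mult_cnj)
  then show "(\<integral>z. f z * cnj (g z) \<partial>circle_measure) = (\<integral>z. f' z * cnj (g' z) \<partial>circle_measure)"
    by (intro integral_cong_AE) auto
qed

text \<open>The real Hilbert space structure underlying the complex one; its norm is the
  \<open>L\<close>-two norm, and it supplies the topology of the library (\<^const>\<open>closed\<close> etc.).\<close>

instantiation l2T :: real_inner
begin

definition inner_l2T :: "l2T \<Rightarrow> l2T \<Rightarrow> real" where
  "inner_l2T f g = Re (cinner f g)"

definition norm_l2T :: "l2T \<Rightarrow> real" where
  "norm_l2T f = sqrt (inner f f)"

definition dist_l2T :: "l2T \<Rightarrow> l2T \<Rightarrow> real" where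
  "dist_l2T f g = norm (f - g)"

definition sgn_l2T :: "l2T \<Rightarrow> l2T" where
  "sgn_l2T f = f /\<^sub>R norm f"

definition uniformity_l2T :: "(l2T \<times> l2T) filter" where
  "uniformity_l2T = (INF e\<in>{0<..}. principal {(f, g). dist f g < e})"

definition open_l2T :: "l2T set \<Rightarrow> bool" where
  "open_l2T U \<longleftrightarrow> (\<forall>f\<in>U. eventually (\<lambda>(f', g). f' = f \<longrightarrow> g \<in> U) uniformity)"

instance
proof
  fix f g k :: l2T and r :: real and U :: "l2T set"
  show "dist f g = norm (f - g)" by (rule dist_l2T_def)
  show "sgn f = f /\<^sub>R norm f" by (rule sgn_l2T_def)
  show "uniformity = (INF e\<in>{0<..}. principal {(f, g :: l2T). dist f g < e})"
    by (rule uniformity_l2T_def)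
  show "open U \<longleftrightarrow> (\<forall>f\<in>U. eventually (\<lambda>(f', g). f' = f \<longrightarrow> g \<in> U) uniformity)"
    by (rule open_l2T_def)
  show "norm f = sqrt (inner f f)" by (rule norm_l2T_def)
  show "inner f g = inner g f"
    unfolding inner_l2T_def
  proof transfer
    fix f g :: "complex \<Rightarrow> complex"
    have "(\<integral>z. g z * cnj (f z) \<partial>circle_measure) = cnj (\<integral>z. f z * cnj (g z) \<partial>circle_measure)"
      by (subst Bochner_Integration.integral_cnj[symmetric]) (simp add: mult.commute)
    then show "Re (\<integral>z. f z * cnj (g z) \<partial>circle_measure) =
        Re (\<integral>z. g z * cnj (f z) \<partial>circle_measure)"
      by simp
  qed
  show "inner (f + g) k = inner f k + inner g k"
    unfolding inner_l2T_def
    by transfer (simp add: l2_rel_def distrib_right integrable_mult_cnj)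
  show "inner (r *\<^sub>R f) g = r * inner f g"
    unfolding inner_l2T_def by transfer (simp add: mult.assoc)
  have sq: "(\<integral>z. f z * cnj (f z) \<partial>circle_measure) =
      of_real (\<integral>z. (cmod (f z))\<^sup>2 \<partial>circle_measure)" for f
    by (subst integral_complex_of_real[symmetric]) (simp only: complex_norm_square)
  show "0 \<le> inner f f"
    unfolding inner_l2T_def by transfer (simp add: sq)
  show "inner f f = 0 \<longleftrightarrow> f = 0"
    unfolding inner_l2T_def
  proof transfer
    fix f assume "l2_rel f f"
    then have f: "f \<in> square_integrable" by (simp add: l2_rel_def)
    then have "(\<integral>z. (cmod (f z))\<^sup>2 \<partial>circle_measure) = 0 \<longleftrightarrow> (AE z in circle_measure. f z = 0)"
      by (subst integral_nonneg_eq_0_iff_AE) (auto simp: square_integrable_def)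
    then show "Re (\<integral>z. f z * cnj (f z) \<partial>circle_measure) = 0 \<longleftrightarrow> l2_rel f (\<lambda>z. 0)"
      by (simp add: sq l2_rel_def f square_integrable_zero)
  qed
qed

end

lift_definition cscale :: "complex \<Rightarrow> l2T \<Rightarrow> l2T" is "\<lambda>c f z. c * f z"
  using square_integrable_cmult by (auto simp: l2_rel_def)

interpretation l2T: vector_space cscale
proof
  fix a b :: complex and x y :: l2T
  show "cscale a (x + y) = cscale a x + cscale a y"
    by transfer (simp add: l2_rel_def square_integrable_add square_integrable_cmult distrib_left)
  show "cscale (a + b) x = cscale a x + cscale b x"
    by transfer (use square_integrable_cmult square_integrable_add in
        \<open>simp add: l2_rel_def distrib_right\<close>)
  show "cscale a (cscale b x) = cscale (a * b) x"
    by transfer (use square_integrable_cmult in \<open>simp add: l2_rel_def mult.assoc\<close>)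
  show "cscale 1 x = x"
    by transfer (simp add: l2_rel_def)
qed

text \<open>The class of the pointwise product \<open>\<phi> f\<close>. Meaningful whenever this product is square
  integrable, in particular for all \<open>f\<close> if \<open>\<phi>\<close> is in \<^const>\<open>Linf\<close>; the value is
  unspecified otherwise.\<close>

definition mult_op :: "(complex \<Rightarrow> complex) \<Rightarrow> l2T \<Rightarrow> l2T" where
  "mult_op \<phi> f = abs_l2T (\<lambda>z. \<phi> z * rep_l2T f z)"

lemma mult_op_AE:
  assumes "\<phi> \<in> Linf"
  shows "AE z in circle_measure. rep_l2T (mult_op \<phi> f) z = \<phi> z * rep_l2T f z"
  unfolding mult_op_def
  by (intro rep_abs_l2T_AE square_integrable_mult_Linf assms rep_l2T_square_integrable)


section \<open>Orthogonality and operators on subspaces\<close>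

definition orth_compl :: "l2T set \<Rightarrow> l2T set" where
  "orth_compl M = {g. \<forall>f\<in>M. cinner g f = 0}"

definition orth_proj :: "l2T set \<Rightarrow> l2T \<Rightarrow> l2T" where
  "orth_proj M f = (THE g. g \<in> M \<and> f - g \<in> orth_compl M)"

definition bounded_clinear_on :: "l2T set \<Rightarrow> l2T set \<Rightarrow> (l2T \<Rightarrow> l2T) \<Rightarrow> bool" where
  "bounded_clinear_on X Y T \<longleftrightarrow>
     T ` X \<subseteq> Y \<and>
     (\<forall>x\<in>X. \<forall>x'\<in>X. T (x + x') = T x + T x') \<and>
     (\<forall>c. \<forall>x\<in>X. T (cscale c x) = cscale c (T x)) \<and>
     (\<exists>K. \<forall>x\<in>X. norm (T x) \<le> K * norm x)"

text \<open>The Hilbert space adjoint \<open>Y \<rightarrow> X\<close> of an operator \<open>T : X \<rightarrow> Y\<close> between closed subspaces.\<close>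

definition adjoint_on :: "l2T set \<Rightarrow> l2T set \<Rightarrow> (l2T \<Rightarrow> l2T) \<Rightarrow> l2T \<Rightarrow> l2T" where
  "adjoint_on X Y T = (\<lambda>y\<in>Y. THE x. x \<in> X \<and> (\<forall>v\<in>X. cinner (T v) y = cinner v x))"

definition orth_decomposition :: "l2T set \<Rightarrow> l2T set \<Rightarrow> bool" where
  "orth_decomposition X Y \<longleftrightarrow>
     l2T.subspace X \<and> l2T.subspace Y \<and> closed X \<and> closed Y \<and>
     (\<forall>x\<in>X. \<forall>y\<in>Y. cinner x y = 0) \<and>
     (\<forall>f. \<exists>x\<in>X. \<exists>y\<in>Y. f = x + y)"

text \<open>\<open>T\<close> is represented with respect to \<open>X \<oplus> Y\<close> by the matrix with rows \<open>A B\<close> and \<open>C D\<close>.\<close>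

definition has_block_matrix ::
  "(l2T \<Rightarrow> l2T) \<Rightarrow> l2T set \<Rightarrow> l2T set \<Rightarrow>
   (l2T \<Rightarrow> l2T) \<Rightarrow> (l2T \<Rightarrow> l2T) \<Rightarrow> (l2T \<Rightarrow> l2T) \<Rightarrow> (l2T \<Rightarrow> l2T) \<Rightarrow> bool" where
  "has_block_matrix T X Y A B C D \<longleftrightarrow>
     orth_decomposition X Y \<and>
     bounded_clinear_on X X A \<and> bounded_clinear_on Y X B \<and>
     bounded_clinear_on X Y C \<and> bounded_clinear_on Y Y D \<and>
     (\<forall>x\<in>X. \<forall>y\<in>Y. T (x + y) = (A x + B y) + (C x + D y))"


section \<open>Hardy space, model spaces and nearly invariant subspaces\<close>

definition fourier_coeff :: "l2T \<Rightarrow> int \<Rightarrow> complex" where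
  "fourier_coeff f n = (\<integral>z. rep_l2T f z * cnj (z powi n) \<partial>circle_measure)"

definition hardy2 :: "l2T set" where
  "hardy2 = {f. \<forall>n<0. fourier_coeff f n = 0}"

text \<open>The analytic function on the open unit disk determined by \<open>f\<close> in \<^const>\<open>hardy2\<close>.\<close>

definition disk_ext :: "l2T \<Rightarrow> complex \<Rightarrow> complex" where
  "disk_ext f w = (\<Sum>n. fourier_coeff f (int n) * w ^ n)"

definition backward_shift :: "l2T \<Rightarrow> l2T" where
  "backward_shift f = abs_l2T (\<lambda>z. (rep_l2T f z - disk_ext f 0) / z)"

definition inner_function :: "l2T \<Rightarrow> bool" where
  "inner_function u \<longleftrightarrow> u \<in> hardy2 \<and> (AE z in circle_measure. cmod (rep_l2T u z) = 1)"

definition model_space :: "l2T \<Rightarrow> l2T set" where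
  "model_space u = hardy2 \<inter> orth_compl (mult_op (rep_l2T u) ` hardy2)"

definition nearly_invariant :: "l2T set \<Rightarrow> bool" where
  "nearly_invariant M \<longleftrightarrow> (\<forall>f\<in>M. disk_ext f 0 = 0 \<longrightarrow> backward_shift f \<in> M)"

definition extremal_function :: "l2T set \<Rightarrow> l2T \<Rightarrow> bool" where
  "extremal_function M h \<longleftrightarrow>
     h \<in> M \<and> norm h = 1 \<and> disk_ext h 0 \<in> \<real> \<and> Re (disk_ext h 0) > 0 \<and>
     h \<in> orth_compl {f \<in> M. disk_ext f 0 = 0}"

text \<open>Multiplication by \<open>h\<close> maps \<open>K\<close> isometrically onto \<open>M\<close>. The first conjunct guarantees
  that \<^term>\<open>mult_op (rep_l2T h) k\<close> is the class of \<open>h k\<close>.\<close>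

definition isometric_multiplier :: "l2T \<Rightarrow> l2T set \<Rightarrow> l2T set \<Rightarrow> bool" where
  "isometric_multiplier h K M \<longleftrightarrow>
     (\<forall>k\<in>K. (\<lambda>z. rep_l2T h z * rep_l2T k z) \<in> square_integrable) \<and>
     (\<forall>k\<in>K. norm (mult_op (rep_l2T h) k) = norm k) \<and>
     mult_op (rep_l2T h) ` K = M"


section \<open>The operators\<close>

definition V_op :: "l2T \<Rightarrow> l2T \<Rightarrow> l2T \<Rightarrow> l2T" where
  "V_op u h = (\<lambda>k\<in>model_space u. mult_op (rep_l2T h) k)"

definition V_adj :: "l2T set \<Rightarrow> l2T \<Rightarrow> l2T \<Rightarrow> l2T \<Rightarrow> l2T" where
  "V_adj M u h = adjoint_on (model_space u) M (V_op u h)"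

definition A_op :: "l2T set \<Rightarrow> l2T \<Rightarrow> l2T \<Rightarrow> (complex \<Rightarrow> complex) \<Rightarrow> l2T \<Rightarrow> l2T" where
  "A_op M u h \<phi> =
     (\<lambda>k\<in>model_space u. V_adj M u h (orth_proj M (mult_op \<phi> (V_op u h k))))"

definition B_op :: "l2T set \<Rightarrow> (complex \<Rightarrow> complex) \<Rightarrow> l2T \<Rightarrow> l2T" where
  "B_op M \<phi> = (\<lambda>f\<in>M. orth_proj (orth_compl M) (mult_op \<phi> f))"

definition D_op :: "l2T set \<Rightarrow> (complex \<Rightarrow> complex) \<Rightarrow> l2T \<Rightarrow> l2T" where
  "D_op M \<phi> = (\<lambda>g\<in>orth_compl M. orth_proj (orth_compl M) (mult_op \<phi> g))"

end

theory Submission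
  imports Defs
begin

text \<open>The entries of the block matrix of \<open>M\<^sub>\<phi>\<close> are compressions: with \<open>P\<close> and \<open>Q = I - P\<close> the
  projections onto \<open>M\<close> and its orthogonal complement, \<open>M\<^sub>\<phi> = (P + Q) M\<^sub>\<phi> (P + Q)\<close>. What has to be
  seen is that the two upper entries are \<open>P M\<^sub>\<phi>\<close>, restricted to \<open>M\<close> and to its complement.

  For the upper left entry, \<open>V\<close> preserves norms, hence by polarization inner products
  (\<open>isometric_multiplier_cinner\<close>), and maps the model space onto \<open>M\<close>; so \<open>V\<^sup>*\<close> is the inverse
  of \<open>V\<close> (\<open>V_adj_mult_op\<close>) and \<open>V A V\<^sup>* = (V V\<^sup>*) P M\<^sub>\<phi> (V V\<^sup>*)\<close> collapses to \<open>P M\<^sub>\<phi>\<close> on \<open>M\<close>.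
  For the upper right entry, the adjoint of multiplication by \<open>cnj \<phi>\<close> is multiplication by
  \<open>\<phi>\<close>, so that the adjoint of \<open>B\<close> with symbol \<open>cnj \<phi>\<close> is \<open>P M\<^sub>\<phi>\<close> on the complement
  (\<open>adjoint_B_op\<close>).

  All this presupposes that the projections exist, that is, that \<open>L\<close>-two of the circle is a
  Hilbert space. Completeness is proved in the manner of Riesz and Fischer; a closed subspace then
  contains a nearest point to every \<open>f\<close>, and this is the projection
  (\<open>exists_orth_proj\<close>).\<close>


section \<open>Representatives and the complex inner product\<close>

lemma rep_l2T_eqI:
  assumes "AE z in circle_measure. rep_l2T f z = rep_l2T g z"
  shows "f = g"
  using assms Quotient3_rel_rep[OF Quotient3_l2T, of f g]
  by (simp add: l2_rel_def rep_l2T_square_integrable)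

lemma rep_l2T_plus_AE:
  "AE z in circle_measure. rep_l2T (f + g) z = rep_l2T f z + rep_l2T g z"
  unfolding plus_l2T_def map_fun_def comp_def
  by (auto intro!: rep_abs_l2T_AE square_integrable_add rep_l2T_square_integrable)

lemma rep_l2T_minus_AE:
  "AE z in circle_measure. rep_l2T (f - g) z = rep_l2T f z - rep_l2T g z"
  using rep_l2T_plus_AE[of "f - g" g] by (auto simp: algebra_simps)

lemma rep_l2T_cscale_AE:
  "AE z in circle_measure. rep_l2T (cscale c f) z = c * rep_l2T f z"
  unfolding cscale_def map_fun_def comp_def
  by (auto intro!: rep_abs_l2T_AE square_integrable_cmult rep_l2T_square_integrable)

lemma cinner_rep: "cinner f g = (\<integral>z. rep_l2T f z * cnj (rep_l2T g z) \<partial>circle_measure)"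
  by (simp add: cinner_def)

lemma borel_measurable_rep_l2T [measurable]: "rep_l2T f \<in> borel_measurable circle_measure"
  using rep_l2T_square_integrable[of f] by (simp add: square_integrable_def)

text \<open>Limit and domination arguments are carried out with nonnegative integrals, where no
  integrability has to be checked in advance; this converts their outcome to norms.\<close>

lemma nn_integral_rep_l2T:
  "(\<integral>\<^sup>+z. ennreal ((cmod (rep_l2T f z))\<^sup>2) \<partial>circle_measure) = ennreal ((norm f)\<^sup>2)"
proof -
  have "cinner f f = of_real (\<integral>z. (cmod (rep_l2T f z))\<^sup>2 \<partial>circle_measure)"
    by (subst integral_complex_of_real[symmetric]) (simp only: complex_norm_square cinner_rep)
  then have "(norm f)\<^sup>2 = (\<integral>z. (cmod (rep_l2T f z))\<^sup>2 \<partial>circle_measure)"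
    by (simp add: power2_norm_eq_inner inner_l2T_def)
  then show ?thesis
    using rep_l2T_square_integrable[of f]
    by (simp add: nn_integral_eq_integral square_integrable_def)
qed

lemma cinner_add_left: "cinner (f + g) k = cinner f k + cinner g k"
  by transfer (simp add: l2_rel_def distrib_right integrable_mult_cnj)

lemma cinner_cscale_left: "cinner (cscale c f) g = c * cinner f g"
  by transfer (simp add: mult.assoc)

lemma cinner_commute: "cinner g f = cnj (cinner f g)"
  by transfer (subst Bochner_Integration.integral_cnj[symmetric], simp add: mult.commute)

lemma cinner_diff_left: "cinner (f - g) k = cinner f k - cinner g k"
  using cinner_add_left[of "f - g" g k] by (simp add: algebra_simps)

lemma cinner_diff_right: "cinner k (f - g) = cinner k f - cinner k g"
  by (metis cinner_diff_left cinner_commute complex_cnj_diff)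

lemma cinner_cscale_right: "cinner f (cscale c g) = cnj c * cinner f g"
  by (metis cinner_cscale_left cinner_commute complex_cnj_mult)

lemma cinner_self_eq_0: "cinner f f = 0 \<Longrightarrow> f = 0"
  using inner_eq_zero_iff[of f] by (simp add: inner_l2T_def)

lemma cinner_zero_left [simp]: "cinner 0 f = 0"
  using cinner_diff_left[of 0 0 f] by simp

text \<open>Through this identity facts about the real inner product of the library (continuity,
  polarization, nearest points) carry over to the complex one.\<close>

lemma cinner_eq_Complex_inner: "cinner f g = Complex (inner f g) (inner f (cscale \<i> g))"
  by (simp add: inner_l2T_def cinner_cscale_right complex_eq_iff)

lemma scaleR_eq_cscale: "r *\<^sub>R f = cscale (of_real r) f"
  by transfer (simp add: l2_rel_def square_integrable_cmult)

lemma subspace_imp_real_subspace: "l2T.subspace M \<Longrightarrow> subspace M"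
  by (simp add: l2T.subspace_def subspace_def scaleR_eq_cscale)


section \<open>Completeness of the space\<close>

text \<open>The argument of Riesz and Fischer: a subsequence whose increments decay geometrically in norm
  converges almost everywhere, because weighted squares of its increments have a finite sum there;
  by Fatou's lemma the pointwise limit is also the limit in norm.\<close>

instance l2T :: complete_space
proof
  fix X :: "nat \<Rightarrow> l2T"
  assume "Cauchy X"
  then have "\<forall>n. \<exists>N. \<forall>p\<ge>N. \<forall>q\<ge>N. norm (X p - X q) < (1/2)^n"
    unfolding Cauchy_iff by simp
  then obtain N where N: "\<And>n p q. N n \<le> p \<Longrightarrow> N n \<le> q \<Longrightarrow> norm (X p - X q) < (1/2)^n"
    by metis
  \<comment> \<open>The index of the subsequence; partial sums make it monotone and at least \<open>N n\<close>.\<close>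
  define r where "r n = (\<Sum>i\<le>n. N i)" for n
  have r: "N n \<le> r m" if "n \<le> m" for n m
    unfolding r_def using that by (intro member_le_sum) auto
  define F where "F n = rep_l2T (X (r n))" for n
  have [measurable]: "F n \<in> borel_measurable circle_measure" for n
    by (simp add: F_def)
  have dist: "(\<integral>\<^sup>+z. ennreal ((cmod (F n z - F m z))\<^sup>2) \<partial>circle_measure) \<le> ennreal ((1/4)^n)"
    if "n \<le> m" for n m
  proof -
    have "(\<integral>\<^sup>+z. ennreal ((cmod (F n z - F m z))\<^sup>2) \<partial>circle_measure)
        = (\<integral>\<^sup>+z. ennreal ((cmod (rep_l2T (X (r n) - X (r m)) z))\<^sup>2) \<partial>circle_measure)"
      using rep_l2T_minus_AE[of "X (r n)" "X (r m)"]
      by (intro nn_integral_cong_AE) (auto simp: F_def elim!: AE_mp)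
    also have "\<dots> \<le> ennreal (((1/2)^n)\<^sup>2)"
      unfolding nn_integral_rep_l2T
      using N[of n "r n" "r m"] r that by (intro ennreal_leI power_mono) (auto intro: less_imp_le)
    also have "((1/2)^n)\<^sup>2 = ((1/4)^n :: real)"
      by (simp add: power2_eq_square flip: power_mult_distrib)
    finally show ?thesis .
  qed
  \<comment> \<open>The increments have squared norm at most \<open>(1/4)^n\<close>, so weighting them by \<open>2^n\<close> still leaves
    a convergent series of integrals.\<close>
  have "(\<integral>\<^sup>+z. (\<Sum>n. ennreal (2^n * (cmod (F n z - F (Suc n) z))\<^sup>2)) \<partial>circle_measure)
      = (\<Sum>n. \<integral>\<^sup>+z. ennreal (2^n * (cmod (F n z - F (Suc n) z))\<^sup>2) \<partial>circle_measure)"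
    by (intro nn_integral_suminf) measurable
  also have "\<dots> \<le> (\<Sum>n. ennreal ((1/2)^n))"
  proof (intro suminf_le summableI)
    fix n
    have "(\<integral>\<^sup>+z. ennreal (2^n * (cmod (F n z - F (Suc n) z))\<^sup>2) \<partial>circle_measure)
        = ennreal (2^n) * (\<integral>\<^sup>+z. ennreal ((cmod (F n z - F (Suc n) z))\<^sup>2) \<partial>circle_measure)"
      by (subst nn_integral_cmult[symmetric]) (auto simp: ennreal_mult)
    also have "\<dots> \<le> ennreal (2^n) * ennreal ((1/4)^n)"
      by (intro mult_left_mono dist) auto
    also have "\<dots> = ennreal ((1/2)^n)"
      by (simp flip: ennreal_mult power_mult_distrib)
    finally show "(\<integral>\<^sup>+z. ennreal (2^n * (cmod (F n z - F (Suc n) z))\<^sup>2) \<partial>circle_measure)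
        \<le> ennreal ((1/2)^n)" .
  qed
  also have "\<dots> < top"
    by (subst suminf_ennreal2) (auto simp: summable_geometric)
  finally have "AE z in circle_measure.
      (\<Sum>n. ennreal (2^n * (cmod (F n z - F (Suc n) z))\<^sup>2)) \<noteq> \<infinity>"
    by (intro nn_integral_PInf_AE) (auto simp: less_top)
  then have lim: "AE z in circle_measure. (\<lambda>n. F n z) \<longlonglongrightarrow> lim (\<lambda>n. F n z)"
  proof eventually_elim
    fix z
    assume "(\<Sum>n. ennreal (2^n * (cmod (F n z - F (Suc n) z))\<^sup>2)) \<noteq> \<infinity>"
    then have sum: "summable (\<lambda>n. 2^n * (cmod (F n z - F (Suc n) z))\<^sup>2)"
      by (intro summable_suminf_not_top) auto
    \<comment> \<open>The arithmetic-geometric mean inequality for \<open>(1/2)^n\<close> and \<open>2^n a\<^sup>2\<close>.\<close>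
    have bound: "a \<le> (1/2)^n + 2^n * a\<^sup>2" if "0 \<le> a" for a :: real and n :: nat
    proof -
      have "0 \<le> 2^n * (a - (1/2)^n)\<^sup>2" by simp
      also have "\<dots> = 2^n * a\<^sup>2 - 2 * a * (2^n * (1/2)^n) + (1/2)^n * (2^n * (1/2)^n)"
        by (simp add: power2_eq_square algebra_simps)
      also have "2^n * (1/2)^n = (1::real)"
        by (simp flip: power_mult_distrib)
      finally show ?thesis using that by simp
    qed
    have "summable (\<lambda>n. F (Suc n) z - F n z)"
    proof (rule summable_comparison_test')
      show "summable (\<lambda>n. (1/2)^n + 2^n * (cmod (F n z - F (Suc n) z))\<^sup>2)"
        by (intro summable_add sum) (simp add: summable_geometric)
      show "norm (F (Suc n) z - F n z) \<le> (1/2)^n + 2^n * (cmod (F n z - F (Suc n) z))\<^sup>2" for n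
        using bound[of "cmod (F n z - F (Suc n) z)" n] by (simp add: norm_minus_commute)
    qed
    then have "convergent (\<lambda>n. \<Sum>i<n. F (Suc i) z - F i z)"
      unfolding summable_iff_convergent .
    then have "convergent (\<lambda>n. F n z - F 0 z)"
      by (simp only: sum_lessThan_telescope[where f = "\<lambda>n. F n z"])
    then have "convergent (\<lambda>n. F n z)"
      using convergent_add[OF _ convergent_const, of "\<lambda>n. F n z - F 0 z" "F 0 z"] by simp
    then show "(\<lambda>n. F n z) \<longlonglongrightarrow> lim (\<lambda>n. F n z)"
      by (simp add: convergent_LIMSEQ_iff)
  qed
  define g where "g z = lim (\<lambda>n. F n z)" for z
  have [measurable]: "g \<in> borel_measurable circle_measure"
    unfolding g_def by (rule borel_measurable_lim_metric) measurable
  have fatou: "(\<integral>\<^sup>+z. ennreal ((cmod (F n z - g z))\<^sup>2) \<partial>circle_measure) \<le> ennreal ((1/4)^n)" for n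
  proof -
    have "(\<integral>\<^sup>+z. ennreal ((cmod (F n z - g z))\<^sup>2) \<partial>circle_measure)
        = (\<integral>\<^sup>+z. liminf (\<lambda>m. ennreal ((cmod (F n z - F m z))\<^sup>2)) \<partial>circle_measure)"
    proof (intro nn_integral_cong_AE, use lim in eventually_elim)
      fix z assume "(\<lambda>n. F n z) \<longlonglongrightarrow> lim (\<lambda>n. F n z)"
      then have "(\<lambda>m. ennreal ((cmod (F n z - F m z))\<^sup>2)) \<longlonglongrightarrow> ennreal ((cmod (F n z - g z))\<^sup>2)"
        unfolding g_def by (intro tendsto_intros tendsto_ennrealI)
      then show "ennreal ((cmod (F n z - g z))\<^sup>2)
          = liminf (\<lambda>m. ennreal ((cmod (F n z - F m z))\<^sup>2))"
        by (intro lim_imp_Liminf[symmetric]) simp_all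
    qed
    also have "\<dots> \<le> liminf (\<lambda>m. \<integral>\<^sup>+z. ennreal ((cmod (F n z - F m z))\<^sup>2) \<partial>circle_measure)"
      by (intro nn_integral_liminf) measurable
    also have "\<dots> \<le> limsup (\<lambda>m. \<integral>\<^sup>+z. ennreal ((cmod (F n z - F m z))\<^sup>2) \<partial>circle_measure)"
      by (intro Liminf_le_Limsup) simp
    also have "\<dots> \<le> ennreal ((1/4)^n)"
      by (intro Limsup_bounded eventually_sequentiallyI[of n] dist)
    finally show ?thesis .
  qed
  have "(\<lambda>z. F 0 z - g z) \<in> square_integrable"
    unfolding square_integrable_def using fatou[of 0]
    by (auto intro!: integrableI_bounded intro: le_less_trans)
  then have "(\<lambda>z. F 0 z + - 1 * (F 0 z - g z)) \<in> square_integrable"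
    by (intro square_integrable_add square_integrable_cmult)
      (simp add: F_def rep_l2T_square_integrable)
  then have g: "g \<in> square_integrable"
    by simp
  have near: "norm (X (r n) - abs_l2T g) \<le> (1/2)^n" for n
  proof -
    have "ennreal ((norm (X (r n) - abs_l2T g))\<^sup>2)
        = (\<integral>\<^sup>+z. ennreal ((cmod (F n z - g z))\<^sup>2) \<partial>circle_measure)"
      unfolding nn_integral_rep_l2T[symmetric]
    proof (rule nn_integral_cong_AE,
        use rep_l2T_minus_AE[of "X (r n)" "abs_l2T g"] rep_abs_l2T_AE[OF g] in eventually_elim)
    qed (simp add: F_def)
    also note fatou
    finally have "(norm (X (r n) - abs_l2T g))\<^sup>2 \<le> (1/4)^n"
      by simp
    also have "(1/4)^n = (((1/2)^n)\<^sup>2 :: real)"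
      by (simp add: power2_eq_square flip: power_mult_distrib)
    finally show ?thesis
      by (rule power2_le_imp_le) simp
  qed
  have "X \<longlonglongrightarrow> abs_l2T g"
  proof (rule LIMSEQ_I)
    fix e :: real assume "0 < e"
    then obtain n where n: "(1/2)^n < e/2"
      using real_arch_pow_inv[of "e/2" "1/2"] by auto
    have "norm (X p - abs_l2T g) < e" if "N n \<le> p" for p
    proof -
      have "norm (X p - abs_l2T g) \<le> norm (X p - X (r n)) + norm (X (r n) - abs_l2T g)"
        using norm_triangle_ineq[of "X p - X (r n)" "X (r n) - abs_l2T g"] by simp
      also have "\<dots> < e"
        using N[of n p "r n"] r[of n n] that near[of n] n by simp
      finally show ?thesis .
    qed
    then show "\<exists>N. \<forall>p\<ge>N. norm (X p - abs_l2T g) < e" by blast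
  qed
  then show "convergent X" by (rule convergentI)
qed


section \<open>Orthogonal projections onto closed subspaces\<close>

lemma subspace_orth_compl: "l2T.subspace (orth_compl M)"
  by (auto simp: l2T.subspace_def orth_compl_def cinner_add_left cinner_cscale_left)

lemma closed_orth_compl: "closed (orth_compl M)"
proof -
  have "orth_compl M = (\<Inter>f\<in>M. {g. inner g f = 0} \<inter> {g. inner g (cscale \<i> f) = 0})"
    by (auto simp: orth_compl_def cinner_eq_Complex_inner complex_eq_iff)
  also have "closed \<dots>"
    by (intro closed_INT ballI closed_Int closed_Collect_eq continuous_intros)
  finally show ?thesis .
qed

text \<open>The projection theorem. A minimising sequence for the distance from \<open>f\<close> to \<open>M\<close> is Cauchy by
  the parallelogram law; its limit \<open>g\<close> is a nearest point. As \<open>g + v\<close> and \<open>g - v\<close> both compete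
  with \<open>g\<close>, the real inner product of \<open>f - g\<close> with every \<open>v\<close> in \<open>M\<close> vanishes, and applying this
  to \<open>\<i> v\<close> as well gives orthogonality in the complex sense.\<close>

lemma exists_orth_proj:
  assumes M: "l2T.subspace M" "closed M"
  shows "\<exists>g\<in>M. f - g \<in> orth_compl M"
proof -
  note sub = subspace_imp_real_subspace[OF M(1)]
  define d where "d = (INF m\<in>M. (norm (f - m))\<^sup>2)"
  have bdd: "bdd_below ((\<lambda>m. (norm (f - m))\<^sup>2) ` M)"
    by (rule bdd_belowI[of _ 0]) auto
  have d_le: "d \<le> (norm (f - m))\<^sup>2" if "m \<in> M" for m
    unfolding d_def using bdd that by (rule cINF_lower)
  have "\<exists>m\<in>M. (norm (f - m))\<^sup>2 < d + inverse (Suc n)" for n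
    unfolding d_def using subspace_0[OF sub]
    by (subst cINF_less_iff[symmetric, OF _ bdd]) auto
  then obtain m where m: "\<And>n. m n \<in> M"
    and md: "\<And>n. (norm (f - m n))\<^sup>2 < d + inverse (real (Suc n))"
    by metis
  \<comment> \<open>The midpoint of two near-minimisers lies in \<open>M\<close>, so the parallelogram law forces them
    close together.\<close>
  have close: "(norm (m p - m q))\<^sup>2 \<le> 2 * inverse (real (Suc p)) + 2 * inverse (real (Suc q))" for p q
  proof -
    have "(norm (m p - m q))\<^sup>2
        = 2 * (norm (f - m p))\<^sup>2 + 2 * (norm (f - m q))\<^sup>2 - 4 * (norm (f - (1/2) *\<^sub>R (m p + m q)))\<^sup>2"
      unfolding power2_norm_eq_inner
      by (simp add: inner_diff_left inner_diff_right inner_add_left inner_add_right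
          inner_commute algebra_simps)
    moreover have "d \<le> (norm (f - (1/2) *\<^sub>R (m p + m q)))\<^sup>2"
      by (intro d_le subspace_scale[OF sub] subspace_add[OF sub] m)
    ultimately show ?thesis using md[of p] md[of q] by linarith
  qed
  have "Cauchy m"
    unfolding Cauchy_iff
  proof (intro allI impI)
    fix e :: real assume "0 < e"
    then obtain n where n: "inverse (real (Suc n)) < e\<^sup>2 / 4"
      using reals_Archimedean[of "e\<^sup>2 / 4"] by auto
    have "norm (m p - m q) < e" if "n \<le> p" "n \<le> q" for p q
    proof (rule power2_less_imp_less)
      have "inverse (real (Suc p)) \<le> inverse (real (Suc n))"
        "inverse (real (Suc q)) \<le> inverse (real (Suc n))"
        using that by (auto intro: le_imp_inverse_le)
      then show "(norm (m p - m q))\<^sup>2 < e\<^sup>2"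
        using close[of p q] n by linarith
    qed (use \<open>0 < e\<close> in simp)
    then show "\<exists>N. \<forall>p\<ge>N. \<forall>q\<ge>N. norm (m p - m q) < e" by blast
  qed
  then obtain g where g: "m \<longlonglongrightarrow> g"
    using Cauchy_convergent convergent_def by blast
  have gM: "g \<in> M"
    using closed_sequentially[OF M(2) _ g] m by blast
  have "(norm (f - g))\<^sup>2 \<le> d + 0"
  proof (rule LIMSEQ_le)
    show "(\<lambda>n. (norm (f - m n))\<^sup>2) \<longlonglongrightarrow> (norm (f - g))\<^sup>2"
      by (intro tendsto_intros g)
    show "(\<lambda>n. d + inverse (real (Suc n))) \<longlonglongrightarrow> d + 0"
      by (intro tendsto_intros LIMSEQ_inverse_real_of_nat)
    show "\<exists>N. \<forall>n\<ge>N. (norm (f - m n))\<^sup>2 \<le> d + inverse (real (Suc n))"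
      using md by (auto intro: less_imp_le)
  qed
  then have "(norm (f - g))\<^sup>2 \<le> (norm (f - z))\<^sup>2" if "z \<in> M" for z
    using d_le[OF that] by linarith
  then have min: "\<forall>z\<in>M. dist f g \<le> dist f z"
    unfolding dist_norm using power2_le_imp_le norm_ge_zero by blast
  have perp: "inner (f - g) v = 0" if v: "v \<in> M" for v
  proof -
    have "inner (f - g) (y - g) \<le> 0" if "y \<in> M" for y
      using any_closest_point_dot[OF subspace_imp_convex[OF sub] M(2) gM that min] .
    from this[of "g + v"] this[of "g - v"] show ?thesis
      using subspace_add[OF sub gM v] subspace_diff[OF sub gM v] by simp
  qed
  have "f - g \<in> orth_compl M"
    unfolding orth_compl_def cinner_eq_Complex_inner
    using perp l2T.subspace_scale[OF M(1)] by (auto simp: complex_eq_iff)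
  with gM show ?thesis by blast
qed

lemma orth_proj_eqI:
  assumes "l2T.subspace M" "g \<in> M" "f - g \<in> orth_compl M"
  shows "orth_proj M f = g"
  unfolding orth_proj_def
proof (rule the_equality)
  fix g' assume g': "g' \<in> M \<and> f - g' \<in> orth_compl M"
  have "(f - g') - (f - g) \<in> orth_compl M"
    using g' assms(3) l2T.subspace_diff[OF subspace_orth_compl] by blast
  moreover have "g - g' \<in> M"
    using g' assms by (intro l2T.subspace_diff) auto
  ultimately have "cinner (g - g') (g - g') = 0"
    by (auto simp: orth_compl_def)
  then show "g' = g"
    using cinner_self_eq_0[of "g - g'"] by simp
qed (use assms in auto)

lemma
  assumes "l2T.subspace M" "closed M"
  shows orth_proj_mem: "orth_proj M f \<in> M"
    and diff_orth_proj_mem: "f - orth_proj M f \<in> orth_compl M"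
  using exists_orth_proj[OF assms, of f] orth_proj_eqI[OF assms(1)] by auto

lemma cinner_orth_compl_right: "f \<in> M \<Longrightarrow> g \<in> orth_compl M \<Longrightarrow> cinner f g = 0"
  by (simp add: orth_compl_def cinner_commute[of f g])

lemma orth_proj_orth_compl:
  assumes "l2T.subspace M" "closed M"
  shows "orth_proj (orth_compl M) f = f - orth_proj M f"
proof (rule orth_proj_eqI[OF subspace_orth_compl diff_orth_proj_mem[OF assms]])
  show "f - (f - orth_proj M f) \<in> orth_compl (orth_compl M)"
    using orth_proj_mem[OF assms, of f]
    by (auto simp: orth_compl_def[of "orth_compl M"] cinner_orth_compl_right)
qed

lemma orth_decomposition_orth_compl:
  assumes "l2T.subspace M" "closed M"
  shows "orth_decomposition M (orth_compl M)"
proof -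
  have "\<exists>x\<in>M. \<exists>y\<in>orth_compl M. f = x + y" for f
    using orth_proj_mem[OF assms, of f] diff_orth_proj_mem[OF assms, of f]
    by (intro bexI[of _ "orth_proj M f"] bexI[of _ "f - orth_proj M f"]) auto
  then show ?thesis
    using assms subspace_orth_compl closed_orth_compl cinner_orth_compl_right
    by (auto simp: orth_decomposition_def)
qed

lemma norm_orth_proj_le:
  assumes "l2T.subspace M" "closed M"
  shows "norm (orth_proj M f) \<le> norm f"
proof -
  let ?p = "orth_proj M f"
  have "inner ?p (f - ?p) = 0"
    by (simp add: inner_l2T_def cinner_orth_compl_right[OF orth_proj_mem diff_orth_proj_mem] assms)
  then have "(norm ?p)\<^sup>2 = inner ?p f"
    by (simp add: inner_diff_right power2_norm_eq_inner)
  also have "\<dots> \<le> norm ?p * norm f"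
    by (rule norm_cauchy_schwarz)
  finally show ?thesis
    by (cases "norm ?p = 0") (auto simp: power2_eq_square)
qed


section \<open>Multiplication operators and their compressions\<close>

text \<open>Square integrability of the products is assumed here instead of boundedness of \<open>\<phi>\<close>: the lemma
  is applied both to symbols in \<^const>\<open>Linf\<close> and to the multiplier \<open>h\<close>, which may be unbounded
  and multiplies only the model space into \<open>L\<close>-two. The product with \<open>rep_l2T (f + g)\<close> is
  listed separately because this representative agrees with the sum of the other two only
  almost everywhere, which does not make the product measurable.\<close>

lemma mult_op_add:
  assumes "(\<lambda>z. \<phi> z * rep_l2T f z) \<in> square_integrable"
    "(\<lambda>z. \<phi> z * rep_l2T g z) \<in> square_integrable"
    "(\<lambda>z. \<phi> z * rep_l2T (f + g) z) \<in> square_integrable"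
  shows "mult_op \<phi> (f + g) = mult_op \<phi> f + mult_op \<phi> g"
  unfolding mult_op_def
  by (rule rep_l2T_eqI, use rep_l2T_plus_AE[of f g] rep_abs_l2T_AE[OF assms(1)]
      rep_abs_l2T_AE[OF assms(2)] rep_abs_l2T_AE[OF assms(3)]
      rep_l2T_plus_AE[of "mult_op \<phi> f" "mult_op \<phi> g", unfolded mult_op_def]
      in eventually_elim) (simp add: distrib_left)

lemma mult_op_cscale:
  assumes "(\<lambda>z. \<phi> z * rep_l2T f z) \<in> square_integrable"
    "(\<lambda>z. \<phi> z * rep_l2T (cscale c f) z) \<in> square_integrable"
  shows "mult_op \<phi> (cscale c f) = cscale c (mult_op \<phi> f)"
  unfolding mult_op_def
  by (rule rep_l2T_eqI, use rep_l2T_cscale_AE[of c f] rep_abs_l2T_AE[OF assms(1)]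
      rep_abs_l2T_AE[OF assms(2)] rep_l2T_cscale_AE[of c "mult_op \<phi> f", unfolded mult_op_def]
      in eventually_elim) simp

lemma bounded_mult_op:
  assumes "\<phi> \<in> Linf"
  shows "\<exists>C. \<forall>f. norm (mult_op \<phi> f) \<le> C * norm f"
proof -
  obtain C where C: "AE z in circle_measure. cmod (\<phi> z) \<le> C"
    using assms by (auto simp: Linf_def)
  have "norm (mult_op \<phi> f) \<le> \<bar>C\<bar> * norm f" for f
  proof -
    have "ennreal ((norm (mult_op \<phi> f))\<^sup>2)
        \<le> (\<integral>\<^sup>+z. ennreal (C\<^sup>2) * ennreal ((cmod (rep_l2T f z))\<^sup>2) \<partial>circle_measure)"
      unfolding nn_integral_rep_l2T[symmetric]
    proof (rule nn_integral_mono_AE, use C mult_op_AE[OF assms, of f] in eventually_elim)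
      fix z assume "cmod (\<phi> z) \<le> C" "rep_l2T (mult_op \<phi> f) z = \<phi> z * rep_l2T f z"
      then show "ennreal ((cmod (rep_l2T (mult_op \<phi> f) z))\<^sup>2)
          \<le> ennreal (C\<^sup>2) * ennreal ((cmod (rep_l2T f z))\<^sup>2)"
        by (auto simp: norm_mult power_mult_distrib simp flip: ennreal_mult
            intro!: ennreal_leI mult_right_mono power_mono)
    qed
    also have "\<dots> = ennreal (C\<^sup>2 * (norm f)\<^sup>2)"
      by (simp add: nn_integral_cmult nn_integral_rep_l2T ennreal_mult)
    finally have "(norm (mult_op \<phi> f))\<^sup>2 \<le> (\<bar>C\<bar> * norm f)\<^sup>2"
      by (simp add: power_mult_distrib)
    then show ?thesis by (rule power2_le_imp_le) simp
  qed
  then show ?thesis by blast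
qed

lemma cnj_Linf: "\<phi> \<in> Linf \<Longrightarrow> (\<lambda>z. cnj (\<phi> z)) \<in> Linf"
  by (auto simp: Linf_def intro!: borel_measurable_continuous_on[of cnj] continuous_intros)

lemma cinner_mult_op_cnj:
  assumes "\<phi> \<in> Linf"
  shows "cinner (mult_op (\<lambda>z. cnj (\<phi> z)) f) g = cinner f (mult_op \<phi> g)"
proof -
  have [measurable]: "(\<lambda>z. cnj (rep_l2T k z)) \<in> borel_measurable circle_measure" for k
    by (intro borel_measurable_continuous_on[of cnj]) (auto intro: continuous_intros)
  have "AE z in circle_measure. rep_l2T (mult_op (\<lambda>z. cnj (\<phi> z)) f) z * cnj (rep_l2T g z)
      = rep_l2T f z * cnj (rep_l2T (mult_op \<phi> g) z)"
    using mult_op_AE[OF cnj_Linf[OF assms], of f] mult_op_AE[OF assms, of g]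
    by eventually_elim simp
  then show ?thesis
    unfolding cinner_rep by (intro integral_cong_AE) measurable
qed

lemma bounded_clinear_on_orth_proj_mult_op:
  assumes N: "l2T.subspace N" "closed N" and "\<phi> \<in> Linf"
  shows "bounded_clinear_on X N (\<lambda>f. orth_proj N (mult_op \<phi> f))"
proof -
  note sq = square_integrable_mult_Linf[OF \<open>\<phi> \<in> Linf\<close> rep_l2T_square_integrable]
  have add: "orth_proj N (mult_op \<phi> (f + g)) = orth_proj N (mult_op \<phi> f) + orth_proj N (mult_op \<phi> g)"
    for f g
    unfolding mult_op_add[OF sq sq sq]
    using l2T.subspace_add[OF subspace_orth_compl diff_orth_proj_mem[OF N] diff_orth_proj_mem[OF N],
        of "mult_op \<phi> f" "mult_op \<phi> g"]
    by (intro orth_proj_eqI N l2T.subspace_add orth_proj_mem) (simp add: algebra_simps)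
  have scale: "orth_proj N (mult_op \<phi> (cscale c f)) = cscale c (orth_proj N (mult_op \<phi> f))" for c f
    unfolding mult_op_cscale[OF sq sq]
    using l2T.subspace_scale[OF subspace_orth_compl diff_orth_proj_mem[OF N], of c "mult_op \<phi> f"]
    by (intro orth_proj_eqI N l2T.subspace_scale orth_proj_mem) (simp add: l2T.scale_right_diff_distrib)
  obtain C where "\<And>f. norm (mult_op \<phi> f) \<le> C * norm f"
    using bounded_mult_op[OF \<open>\<phi> \<in> Linf\<close>] by blast
  then have "norm (orth_proj N (mult_op \<phi> f)) \<le> C * norm f" for f
    using norm_orth_proj_le[OF N] order_trans by blast
  then show ?thesis
    using add scale orth_proj_mem[OF N] by (auto simp: bounded_clinear_on_def)
qed


section \<open>The unitary \<open>V\<close> and its adjoint\<close>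

lemma powi_square_integrable: "(\<lambda>z. z powi n) \<in> square_integrable"
proof -
  interpret finite_measure circle_measure
    by (rule finite_measureI) (simp add: emeasure_circle_measure_space)
  have space: "space circle_measure = sphere 0 1"
    by (simp add: circle_measure_def space_restrict_space)
  have "(\<lambda>z :: complex. z powi n) \<in> borel_measurable (restrict_space borel (sphere 0 1))"
    by (intro borel_measurable_continuous_on_restrict continuous_on_power_int continuous_on_id) auto
  then have "(\<lambda>z. z powi n) \<in> borel_measurable circle_measure"
    by (simp add: circle_measure_def)
  moreover have "integrable circle_measure (\<lambda>z. (cmod (z powi n))\<^sup>2)
      \<longleftrightarrow> integrable circle_measure (\<lambda>z. 1 :: real)"
    by (intro Bochner_Integration.integrable_cong) (auto simp: space norm_power_int)
  ultimately show ?thesis by (simp add: square_integrable_def)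
qed

lemma fourier_coeff_eq_cinner: "fourier_coeff f n = cinner f (abs_l2T (\<lambda>z. z powi n))"
proof -
  note powi = powi_square_integrable[of n]
  note int = integrable_mult_cnj[OF rep_l2T_square_integrable, THEN borel_measurable_integrable]
  have "AE z in circle_measure. rep_l2T f z * cnj (z powi n)
      = rep_l2T f z * cnj (rep_l2T (abs_l2T (\<lambda>z. z powi n)) z)"
    using rep_abs_l2T_AE[OF powi] by eventually_elim simp
  then show ?thesis
    unfolding fourier_coeff_def cinner_rep
    by (intro integral_cong_AE int powi rep_l2T_square_integrable)
qed

text \<open>The Hardy space is itself an orthogonal complement, namely that of the negative powers of the
  variable, so the model space is an intersection of two orthogonal complements.\<close>

lemma subspace_model_space: "l2T.subspace (model_space u)"
proof -
  have "hardy2 = orth_compl ((\<lambda>n. abs_l2T (\<lambda>z. z powi n)) ` {..<0})"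
    by (auto simp: hardy2_def orth_compl_def fourier_coeff_eq_cinner)
  then have "l2T.subspace hardy2"
    by (metis subspace_orth_compl)
  then show ?thesis
    unfolding model_space_def by (intro l2T.subspace_inter subspace_orth_compl)
qed

text \<open>The value of the adjoint is unique: two candidates in \<open>X\<close> have the same inner product with every
  element of \<open>X\<close>, in particular with each candidate, so their difference is orthogonal to itself.\<close>

lemma adjoint_on_eqI:
  assumes "y \<in> Y" "x \<in> X" "\<And>v. v \<in> X \<Longrightarrow> cinner (T v) y = cinner v x"
  shows "adjoint_on X Y T y = x"
proof -
  have "(THE x. x \<in> X \<and> (\<forall>v\<in>X. cinner (T v) y = cinner v x)) = x"
  proof (rule the_equality)
    fix x' assume x': "x' \<in> X \<and> (\<forall>v\<in>X. cinner (T v) y = cinner v x')"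
    have "cinner v x = cinner v x'" if "v \<in> X" for v
      using assms(3)[OF that] x' that by metis
    then have "cinner (x - x') (x - x') = 0"
      using x' assms(2) by (simp add: cinner_diff_left cinner_diff_right)
    then show "x' = x"
      using cinner_self_eq_0[of "x - x'"] by simp
  qed (use assms in auto)
  then show ?thesis using assms by (simp add: adjoint_on_def)
qed

text \<open>By polarization the real inner product is determined by norms of sums, which \<open>h\<close> preserves; the
  imaginary part of the complex inner product is the real one with \<open>g\<close> replaced by \<open>\<i> g\<close>.\<close>

lemma isometric_multiplier_cinner:
  assumes K: "l2T.subspace K" and h: "isometric_multiplier h K M" and "f \<in> K" "g \<in> K"
  shows "cinner (mult_op (rep_l2T h) f) (mult_op (rep_l2T h) g) = cinner f g"
proof -
  let ?V = "mult_op (rep_l2T h)"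
  have sq: "(\<lambda>z. rep_l2T h z * rep_l2T k z) \<in> square_integrable" if "k \<in> K" for k
    using h that by (simp add: isometric_multiplier_def)
  have norm: "norm (?V k) = norm k" if "k \<in> K" for k
    using h that by (simp add: isometric_multiplier_def)
  have inner: "inner (?V f) (?V g) = inner f g" if "f \<in> K" "g \<in> K" for f g
    using that l2T.subspace_add[OF K that]
    by (simp add: dot_norm norm flip: mult_op_add[OF sq sq sq])
  have "?V (cscale \<i> g) = cscale \<i> (?V g)"
    using assms l2T.subspace_scale[OF K] by (intro mult_op_cscale sq) auto
  then show ?thesis
    using inner[of f g] inner[of f "cscale \<i> g"] assms l2T.subspace_scale[OF K]
    by (simp add: cinner_eq_Complex_inner)
qed

lemma V_adj_mult_op:
  assumes "isometric_multiplier h (model_space u) M" "k \<in> model_space u"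
  shows "V_adj M u h (mult_op (rep_l2T h) k) = k"
  unfolding V_adj_def
proof (rule adjoint_on_eqI)
  show "mult_op (rep_l2T h) k \<in> M"
    using assms by (auto simp: isometric_multiplier_def)
qed (use assms in \<open>simp_all add: V_op_def isometric_multiplier_cinner[OF subspace_model_space]\<close>)

text \<open>Since \<open>V\<^sup>*\<close> inverts \<open>V\<close>, conjugation by \<open>V\<close> turns the operator \<open>A\<close> on the model space
  back into the compression of \<open>M\<^sub>\<phi>\<close> to \<open>M\<close>.\<close>

lemma V_A_V_adj_eq:
  assumes M: "l2T.subspace M" "closed M" and h: "isometric_multiplier h (model_space u) M"
    and f: "f \<in> M"
  shows "(V_op u h \<circ> A_op M u h \<phi> \<circ> V_adj M u h) f = orth_proj M (mult_op \<phi> f)"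
proof -
  have M_eq: "mult_op (rep_l2T h) ` model_space u = M"
    using h by (simp add: isometric_multiplier_def)
  obtain k where k: "k \<in> model_space u" "f = mult_op (rep_l2T h) k"
    using f M_eq by blast
  obtain l where l: "l \<in> model_space u" "orth_proj M (mult_op \<phi> f) = mult_op (rep_l2T h) l"
    using orth_proj_mem[OF M, of "mult_op \<phi> f"] M_eq by blast
  have "A_op M u h \<phi> k = l"
    using V_adj_mult_op[OF h l(1)] k l(2) by (simp add: A_op_def V_op_def)
  then show ?thesis
    using V_adj_mult_op[OF h k(1)] k l by (simp add: V_op_def)
qed


section \<open>The block matrix\<close>

text \<open>The entries of the matrix agree with compressions of \<open>M\<^sub>\<phi>\<close> only on their domains, whence the
  need for this congruence rule.\<close>

lemma bounded_clinear_on_cong: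
  assumes "l2T.subspace X" "\<And>x. x \<in> X \<Longrightarrow> S x = T x" "bounded_clinear_on X Y T"
  shows "bounded_clinear_on X Y S"
  using assms l2T.subspace_add[OF assms(1)] l2T.subspace_scale[OF assms(1)]
  unfolding bounded_clinear_on_def by (auto simp: image_subset_iff)

text \<open>For \<open>v\<close> in \<open>M\<close> and \<open>g\<close> orthogonal to \<open>M\<close>, both projections are absorbed by the inner product:
  \<open>\<langle>Q (cnj \<phi> v), g\<rangle> = \<langle>cnj \<phi> v, g\<rangle> = \<langle>v, \<phi> g\<rangle> = \<langle>v, P (\<phi> g)\<rangle>\<close>.\<close>

lemma adjoint_B_op:
  assumes M: "l2T.subspace M" "closed M" and "\<phi> \<in> Linf" and g: "g \<in> orth_compl M"
  shows "adjoint_on M (orth_compl M) (B_op M (\<lambda>z. cnj (\<phi> z))) g = orth_proj M (mult_op \<phi> g)"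
proof (rule adjoint_on_eqI[OF g orth_proj_mem[OF M]])
  fix v assume v: "v \<in> M"
  let ?w = "mult_op (\<lambda>z. cnj (\<phi> z)) v"
  have "cinner (B_op M (\<lambda>z. cnj (\<phi> z)) v) g = cinner ?w g"
    using cinner_orth_compl_right[OF orth_proj_mem[OF M] g, of ?w] v
    by (simp add: B_op_def orth_proj_orth_compl[OF M] cinner_diff_left)
  also have "\<dots> = cinner v (mult_op \<phi> g)"
    by (rule cinner_mult_op_cnj) fact
  also have "\<dots> = cinner v (orth_proj M (mult_op \<phi> g))"
    using cinner_orth_compl_right[OF v diff_orth_proj_mem[OF M], of "mult_op \<phi> g"]
    by (simp add: cinner_diff_right)
  finally show "cinner (B_op M (\<lambda>z. cnj (\<phi> z)) v) g = cinner v (orth_proj M (mult_op \<phi> g))" .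
qed

theorem proposition3p13:
  fixes M :: "l2T set" and u h :: l2T and \<phi> :: "complex \<Rightarrow> complex"
  assumes "l2T.subspace M" and "closed M"
    and "M \<subset> hardy2" and "M \<noteq> {0}"
    and "nearly_invariant M"
    and "inner_function u" and "\<nexists>c. u = abs_l2T (\<lambda>z. c)" and "disk_ext u 0 = 0"
    and "extremal_function M h"
    and "isometric_multiplier h (model_space u) M"
    and "\<phi> \<in> Linf"
  shows "has_block_matrix (mult_op \<phi>) M (orth_compl M)
           (V_op u h \<circ> A_op M u h \<phi> \<circ> V_adj M u h)
           (adjoint_on M (orth_compl M) (B_op M (\<lambda>z. cnj (\<phi> z))))
           (B_op M \<phi>)
           (D_op M \<phi>)"
proof -
  note M = assms(1,2) and phi = \<open>\<phi> \<in> Linf\<close>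
  let ?N = "orth_compl M"
  let ?P = "\<lambda>X f. orth_proj X (mult_op \<phi> f)"
  note N = subspace_orth_compl[of M] closed_orth_compl[of M]
  note bounded = bounded_clinear_on_orth_proj_mult_op[OF M phi]
    bounded_clinear_on_orth_proj_mult_op[OF N phi]
  have A: "(V_op u h \<circ> A_op M u h \<phi> \<circ> V_adj M u h) f = ?P M f" if "f \<in> M" for f
    using M assms(10) that by (rule V_A_V_adj_eq)
  have B: "adjoint_on M ?N (B_op M (\<lambda>z. cnj (\<phi> z))) g = ?P M g" if "g \<in> ?N" for g
    using M phi that by (rule adjoint_B_op)
  have C: "B_op M \<phi> f = ?P ?N f" if "f \<in> M" for f
    using that by (simp add: B_op_def)
  have D: "D_op M \<phi> g = ?P ?N g" if "g \<in> ?N" for g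
    using that by (simp add: D_op_def)
  have sum: "mult_op \<phi> (f + g) = (?P M f + ?P M g) + (?P ?N f + ?P ?N g)" for f g
    using mult_op_add[of \<phi> f g] square_integrable_mult_Linf[OF phi rep_l2T_square_integrable]
    by (simp add: orth_proj_orth_compl[OF M])
  show ?thesis
    unfolding has_block_matrix_def
    using orth_decomposition_orth_compl[OF M] sum
      bounded_clinear_on_cong[OF M(1) A bounded(1)] bounded_clinear_on_cong[OF N(1) B bounded(1)]
      bounded_clinear_on_cong[OF M(1) C bounded(2)] bounded_clinear_on_cong[OF N(1) D bounded(2)]
    by (simp add: A B C D del: o_apply)
qed

end
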